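(* Let $D$ be an algebraically closed field and $d\ge 2$. In the Coefficient-Choosing Game with parameters $D$ and $d$, Wanda wins (regardless of who is Player I).
   Context: The Coefficient-Choosing Game with parameters an integral domain $D$ and a degree $d\ge 2$: one of two players, Wanda or Nora, is designated Player I and the other Player II. Starting with Player I, the players alternately choose the coefficients $a_0,\dots,a_d\in D$ of a polynomial $f(x)=a_dx^d+\cdots+a_1x+a_0$; on each turn the player picks any not-yet-chosen index $i$ (the order is not predetermined) and a value $a_i\in D$, subject to the rule that $a_d\neq 0$ and $a_0\neq 0$. When all $d+1$ coefficients are chosen, Wanda wins if $f$ has a root in the field of fractions of $D$, and Nora wins otherwise. *)

theory Defs
  imports "HOL-Computational_Algebra.Computational_Algebra"
begin

text \<open>
  The Coefficient-Choosing Game over an integral domain \<open>'a\<close>, with degree \<open>d\<close>. A move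
  \<open>(i, c)\<close> sets the coefficient of \<open>x ^ i\<close> to \<open>c\<close>; a (possibly unfinished) play is the list
  of the moves made so far, in order.
\<close>

datatype player = Wanda | Nora

fun opponent :: "player \<Rightarrow> player" where
  "opponent Wanda = Nora"
| "opponent Nora = Wanda"

type_synonym 'a play = "(nat \<times> 'a) list"

definition legal_play :: "nat \<Rightarrow> 'a::idom play \<Rightarrow> bool" where
  "legal_play d ms \<longleftrightarrow>
     distinct (map fst ms) \<and>
     (\<forall>(i, c) \<in> set ms. i \<le> d \<and> (i = 0 \<or> i = d \<longrightarrow> c \<noteq> 0))"

definition complete_play :: "nat \<Rightarrow> 'a::idom play \<Rightarrow> bool" where
  "complete_play d ms \<longleftrightarrow> legal_play d ms \<and> length ms = d + 1"

definition mover :: "player \<Rightarrow> nat \<Rightarrow> player" \<comment> \<open>moves are counted from 0\<close> where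
  "mover first k = (if even k then first else opponent first)"

definition play_poly :: "'a::idom play \<Rightarrow> 'a poly" where
  "play_poly ms = (\<Sum>(i, c) \<leftarrow> ms. monom c i)"

definition winner :: "'a::idom play \<Rightarrow> player" where
  "winner ms =
     (if \<exists>x :: 'a fract. poly (fract_poly (play_poly ms)) x = 0 then Wanda else Nora)"

definition follows :: "player \<Rightarrow> player \<Rightarrow> ('a::idom play \<Rightarrow> nat \<times> 'a) \<Rightarrow> 'a play \<Rightarrow> bool" where
  "follows first p \<sigma> ms \<longleftrightarrow>
     (\<forall>k < length ms. mover first k = p \<longrightarrow> ms ! k = \<sigma> (take k ms))"

text \<open>
  Besides winning every complete play that follows it, a winning strategy must prescribe a legal
  move wherever it is consulted; otherwise a strategy that gets stuck would win vacuously.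
\<close>

definition winning_strategy ::
    "nat \<Rightarrow> player \<Rightarrow> player \<Rightarrow> ('a::idom play \<Rightarrow> nat \<times> 'a) \<Rightarrow> bool" where
  "winning_strategy d first p \<sigma> \<longleftrightarrow>
     (\<forall>ms. legal_play d ms \<and> length ms < d + 1 \<and> follows first p \<sigma> ms \<and> mover first (length ms) = p
        \<longrightarrow> legal_play d (ms @ [\<sigma> ms])) \<and>
     (\<forall>ms. complete_play d ms \<and> follows first p \<sigma> ms \<longrightarrow> winner ms = p)"

definition wins_game :: "'a::idom itself \<Rightarrow> nat \<Rightarrow> player \<Rightarrow> player \<Rightarrow> bool" where
  "wins_game _ d first p \<longleftrightarrow> (\<exists>\<sigma> :: 'a play \<Rightarrow> nat \<times> 'a. winning_strategy d first p \<sigma>)"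

end

theory Submission
  imports Defs
begin

text \<open>
  Since the leading coefficient is never zero, the finished polynomial has degree \<open>d > 0\<close> and
  thus a root, however the game is played; Wanda only has to keep making legal moves.
\<close>

text \<open>As the indices are distinct, no two monomials of the sum share an exponent, so nothing
  is added to the value chosen at \<open>i\<close>.\<close>

lemma coeff_play_poly:
  assumes "distinct (map fst ms)" and "(i, c) \<in> set ms"
  shows "coeff (play_poly ms) i = c"
  using assms
proof (induction ms)
  case (Cons m ms)
  have absent: "coeff (play_poly ns) j = 0" if "j \<notin> fst ` set ns" for ns :: "'a play" and j
    using that by (induction ns) (auto simp: play_poly_def)
  obtain j b where "m = (j, b)" by fastforce
  moreover have "play_poly ((j, b) # ms) = monom b j + play_poly ms"
    by (simp add: play_poly_def)
  ultimately show ?case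
    using Cons absent[of i ms] by (cases "i = j") (auto simp: image_iff)
qed simp

lemma legal_play_indices: "legal_play d ms \<Longrightarrow> fst ` set ms \<subseteq> {..d}"
  by (auto simp: legal_play_def)

lemma card_indices: "legal_play d ms \<Longrightarrow> card (fst ` set ms) = length ms"
  by (metis distinct_card legal_play_def length_map list.set_map)

text \<open>Carries a root in the field itself over to its field of fractions, where
  \<open>winner\<close> looks for one.\<close>

lemma poly_fract_poly_to_fract: "poly (fract_poly p) (to_fract x) = to_fract (poly p x)"
  by (induction p) (simp_all add: map_poly_pCons)

lemma winner_complete_play:
  fixes ms :: "'a::alg_closed_field play"
  assumes "complete_play d ms" and "d > 0"
  shows "winner ms = Wanda"
proof -
  have legal: "legal_play d ms" and "length ms = d + 1"
    using assms(1) by (auto simp: complete_play_def)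
  \<comment> \<open>Counting: \<open>d + 1\<close> distinct indices within \<open>{..d}\<close>
    exhaust it, so some move has set the leading coefficient.\<close>
  then have "fst ` set ms = {..d}"
    by (intro card_subset_eq) (simp_all add: legal_play_indices card_indices)
  then obtain c where c: "(d, c) \<in> set ms" by (metis atMost_iff imageE order_refl prod.collapse)
  then have "c \<noteq> 0" using legal by (auto simp: legal_play_def)
  then have "coeff (play_poly ms) d \<noteq> 0"
    using coeff_play_poly c legal by (auto simp: legal_play_def)
  then have "degree (play_poly ms) > 0"
    using \<open>d > 0\<close> le_degree by fastforce
  then obtain x where "poly (play_poly ms) x = 0"
    using alg_closed_imp_poly_has_root by blast
  then have "poly (fract_poly (play_poly ms)) (to_fract x) = 0"
    by (simp add: poly_fract_poly_to_fract)
  then show ?thesis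
    unfolding winner_def by metis
qed

text \<open>The value 1 is nonzero and hence legal at every index, including 0 and
  \<open>d\<close>.\<close>

definition fill_least :: "'a::idom play \<Rightarrow> nat \<times> 'a" where
  "fill_least ms = (LEAST i. i \<notin> fst ` set ms, 1)"

lemma legal_play_fill_least:
  assumes "legal_play d ms" and "length ms < d + 1"
  shows "legal_play d (ms @ [fill_least ms])"
proof -
  let ?i = "LEAST i. i \<notin> fst ` set ms"
  \<comment> \<open>The least free index is sought among all naturals; by pigeonhole some index
    \<open>j\<close> \<le> \<open>d\<close> is still free, which bounds it by
    \<open>d\<close>.\<close>
  have "card (fst ` set ms) < card {..d}"
    using assms by (simp add: card_indices)
  then obtain j where "j \<le> d" "j \<notin> fst ` set ms"
    by (metis List.finite_set atMost_iff card_mono finite_imageI not_less subsetI)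
  then have "?i \<le> d" "?i \<notin> fst ` set ms"
    by (meson Least_le order_trans) (rule LeastI, fact)
  then show ?thesis
    using assms(1) by (auto simp: legal_play_def fill_least_def)
qed

theorem theorem8p1:
  fixes d :: nat
  assumes "d \<ge> 2"
  shows "\<forall>first. wins_game TYPE('a::alg_closed_field) d first Wanda"
proof -
  have "winning_strategy d first Wanda (fill_least :: 'a play \<Rightarrow> _)" for first
    using assms by (auto simp: winning_strategy_def legal_play_fill_least intro: winner_complete_play)
  then show ?thesis
    unfolding wins_game_def by blast
qed

end
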